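(* Let $G$ be a nontrivial connected graph and let $\overline{G}$ denote its complement. Suppose that $\overline{G}$ falls in neither of the following two cases: (i) $\overline{G}$ is connected with $\mathrm{diam}(\overline{G})\in\{2,3\}$; (ii) $\overline{G}$ has exactly two connected components and one of them is trivial (a single vertex). Then $rc(G)\leq 4$. Furthermore, this bound is best possible: there exist connected graphs $G$ satisfying these hypotheses with $rc(G)=4$.
   Context: All graphs are finite, undirected and simple. For an edge-coloring $c:E(G)\to\{1,\dots,k\}$ (adjacent edges may receive the same color), a path is rainbow if no two of its edges have the same color; $G$ is rainbow connected under $c$ if every two vertices are joined by a rainbow path. The rainbow connection number $rc(G)$ of a nontrivial connected graph $G$ is the minimum $k$ for which such a coloring with $k$ colors exists. $\mathrm{diam}(H)$ denotes the diameter of a connected graph $H$, and $\overline{G}$ is the complement of $G$. *)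

theory Defs
  imports "Graph_Theory.Graph_Theory" "HOL-Library.FuncSet"
begin

text \<open>
  Finite simple undirected graphs are the \<^locale>\<open>pair_graph\<close>s of the library: finite, loop-free,
  symmetric digraphs whose arcs are pairs of vertices. An undirected edge \<open>uv\<close> is represented by
  the two arcs \<open>(u, v)\<close> and \<open>(v, u)\<close>; colourings are therefore given on the two-element sets
  \<open>{u, v}\<close>, so that both arcs necessarily receive the same colour.
\<close>

definition uedge :: "'a \<times> 'a \<Rightarrow> 'a set" where
  "uedge e = {fst e, snd e}"

definition uedges :: "'a pair_pre_digraph \<Rightarrow> 'a set set" where
  "uedges G = uedge ` parcs G"

definition complement :: "'a pair_pre_digraph \<Rightarrow> 'a pair_pre_digraph" where
  "complement G =
    \<lparr> pverts = pverts G,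
      parcs = {(u, v). u \<in> pverts G \<and> v \<in> pverts G \<and> u \<noteq> v \<and> (u, v) \<notin> parcs G} \<rparr>"

definition nontrivial_graph :: "'a pair_pre_digraph \<Rightarrow> bool" where
  "nontrivial_graph G \<longleftrightarrow> card (pverts G) \<ge> 2"

text \<open>
  With unit weights, \<open>\<mu>\<close> is the usual graph distance (infinite if there is no walk).
\<close>

definition diam :: "'a pair_pre_digraph \<Rightarrow> ereal" where
  "diam G = (SUP (u, v) \<in> pverts G \<times> pverts G. wf_digraph.\<mu> (with_proj G) (\<lambda>_. 1) u v)"

text \<open>
  In a symmetric digraph the strongly connected components are exactly the connected components
  of the underlying undirected graph.
\<close>

abbreviation components :: "'a pair_pre_digraph \<Rightarrow> ('a, 'a \<times> 'a) pre_digraph set" where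
  "components G \<equiv> pre_digraph.sccs (with_proj G)"

definition edge_coloring :: "'a pair_pre_digraph \<Rightarrow> nat \<Rightarrow> ('a set \<Rightarrow> nat) \<Rightarrow> bool" where
  "edge_coloring G k c \<longleftrightarrow> c \<in> uedges G \<rightarrow> {1..k}"

definition rainbow :: "('a set \<Rightarrow> nat) \<Rightarrow> ('a \<times> 'a) awalk \<Rightarrow> bool" where
  "rainbow c p \<longleftrightarrow> distinct (map (\<lambda>e. c (uedge e)) p)"

definition rainbow_connected :: "'a pair_pre_digraph \<Rightarrow> ('a set \<Rightarrow> nat) \<Rightarrow> bool" where
  "rainbow_connected G c \<longleftrightarrow>
    (\<forall>u \<in> pverts G. \<forall>v \<in> pverts G. \<exists>p. pre_digraph.apath (with_proj G) u p v \<and> rainbow c p)"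

text \<open>
  Meaningful for finite connected graphs only: there, giving distinct colours to all edges shows
  that the set of admissible \<open>k\<close> is nonempty.
\<close>

definition rc :: "'a pair_pre_digraph \<Rightarrow> nat" where
  "rc G = (LEAST k. \<exists>c. edge_coloring G k c \<and> rainbow_connected G c)"

end

theory Submission
  imports Defs
begin

text \<open>
  Call \<open>l : V \<rightarrow> {0,\<dots>,4}\<close> a five-layering if vertices whose layers differ by at least two
  are adjacent in \<open>G\<close> and the layers 0, 1, 3, 4 are inhabited. Colour the edges between layers by
  \<open>13, 02 \<mapsto> 1\<close>, \<open>03, 24 \<mapsto> 2\<close>, \<open>04 \<mapsto> 3\<close>, \<open>14 \<mapsto> 4\<close>, and all others arbitrarily. The closed walk
  \<open>0-3-1-4-0\<close> is rainbow and joins any two vertices of one of the layers 0, 1, 3, 4; the walk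
  \<open>2-0-4-2\<close> serves layer 2, and \<open>0-3-1\<close>, \<open>1-4-2\<close>, \<open>2-0-3\<close>, \<open>3-0-4\<close> serve consecutive layers.

  If the complement is connected of diameter at least 4, the distance layers from an end of a
  diametral pair (with everything at distance \<open>\<ge> 4\<close> merged) form a five-layering. If the
  complement is disconnected, then either \<open>G\<close> is complete, or a nontrivial component of the complement and the
  union of the other components are completely joined in \<open>G\<close>; splitting each of these two sides
  into a single vertex and the rest gives a five-layering with empty layer 2.

  The bound is attained by \<open>K\<^sub>m\<^sub>,\<^sub>n\<close> with \<open>m \<ge> 2\<close> and \<open>n > 3\<^sup>m\<close>: under a colouring with three colours
  two vertices of the large side see the same colours, and a rainbow path between them, being of
  even length at most three, has length two.
\<close>

section \<open>Rainbow colourings\<close>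

definition rainbow_colorable :: "'a pair_pre_digraph \<Rightarrow> nat \<Rightarrow> bool" where
  "rainbow_colorable G k \<longleftrightarrow> (\<exists>c. edge_coloring G k c \<and> rainbow_connected G c)"

lemma rc_le: "rainbow_colorable G k \<Longrightarrow> rc G \<le> k"
  unfolding rainbow_colorable_def rc_def by (rule Least_le)

lemma rc_eqI:
  assumes "rainbow_colorable G k" and "\<And>j. rainbow_colorable G j \<Longrightarrow> k \<le> j"
  shows "rc G = k"
  using assms unfolding rainbow_colorable_def rc_def by (rule Least_equality)

lemma rainbow_colorable_mono: "rainbow_colorable G j \<Longrightarrow> j \<le> k \<Longrightarrow> rainbow_colorable G k"
  unfolding rainbow_colorable_def edge_coloring_def by (fastforce simp: Pi_iff)

lemma rainbow_length_le:
  assumes "edge_coloring G k c" "set p \<subseteq> parcs G" "rainbow c p"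
  shows "length p \<le> k"
proof -
  let ?colors = "map (\<lambda>e. c (uedge e)) p"
  have "set ?colors \<subseteq> {1..k}"
    using assms(1,2) by (fastforce simp: edge_coloring_def uedges_def)
  then have "card (set ?colors) \<le> k"
    using card_mono[of "{1..k}"] by simp
  then show ?thesis
    using assms(3) by (simp only: rainbow_def distinct_card length_map)
qed

definition rainbow_joined ::
    "'a pair_pre_digraph \<Rightarrow> ('a set \<Rightarrow> nat) \<Rightarrow> 'a \<Rightarrow> 'a \<Rightarrow> bool" where
  "rainbow_joined G c u v \<longleftrightarrow> (\<exists>p. pre_digraph.apath (with_proj G) u p v \<and> rainbow c p)"

lemma rainbow_connected_iff_joined:
  "rainbow_connected G c \<longleftrightarrow> (\<forall>u \<in> pverts G. \<forall>v \<in> pverts G. rainbow_joined G c u v)"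
  by (simp add: rainbow_connected_def rainbow_joined_def)

lemma rainbow_rev_path: "rainbow c (rev_path p) \<longleftrightarrow> rainbow c p"
proof -
  have "map (\<lambda>e. c (uedge e)) (rev_path p) = rev (map (\<lambda>e. c (uedge e)) p)"
    by (induction p) (auto simp: uedge_def insert_commute)
  then show ?thesis
    unfolding rainbow_def by simp
qed

lemma (in pair_sym_digraph) rainbow_joined_sym:
  "rainbow_joined G c u v \<Longrightarrow> rainbow_joined G c v u"
  unfolding rainbow_joined_def by (metis apath_rev_path rainbow_rev_path)

lemma pawalk_verts_vwalk_arcs: "vs \<noteq> [] \<Longrightarrow> pawalk_verts (hd vs) (vwalk_arcs vs) = vs"
  by (induction vs rule: vwalk_arcs.induct) auto

lemma vwalk_arcs_map: "vwalk_arcs (map f vs) = map (map_prod f f) (vwalk_arcs vs)"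
  by (induction vs rule: vwalk_arcs.induct) auto

lemma (in pair_wf_digraph) awalk_vwalk_arcs:
  "vwalk vs (with_proj G) \<Longrightarrow> awalk (hd vs) (vwalk_arcs vs) (last vs)"
  by (induction vs rule: vwalk_induct) (auto simp: awalk_simps dest: in_arcsD1)

lemma (in pair_wf_digraph) rainbow_joined_vpath:
  assumes "vpath vs (with_proj G)" "rainbow c (vwalk_arcs vs)"
  shows "rainbow_joined G c (hd vs) (last vs)"
proof -
  have "vwalk vs (with_proj G)" "distinct vs" "vs \<noteq> []"
    using assms(1) by auto
  then have "apath (hd vs) (vwalk_arcs vs) (last vs)"
    by (simp add: apath_def awalk_vwalk_arcs pawalk_verts_vwalk_arcs)
  with assms(2) show ?thesis
    unfolding rainbow_joined_def by blast
qed

lemma (in pair_wf_digraph) rainbow_joined_refl: "u \<in> pverts G \<Longrightarrow> rainbow_joined G c u u"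
  using rainbow_joined_vpath[of "[u]" c] by (simp add: vpath_def rainbow_def)

lemma (in pair_loopfree_digraph) rainbow_joined_arc:
  "(u, v) \<in> parcs G \<Longrightarrow> rainbow_joined G c u v"
  using rainbow_joined_vpath[of "[u, v]" c]
  by (auto simp: vpath_def rainbow_def dest: in_arcsD2 no_loops')

lemma (in pair_loopfree_digraph) rainbow_colorable_complete:
  assumes "\<And>u v. u \<in> pverts G \<Longrightarrow> v \<in> pverts G \<Longrightarrow> u \<noteq> v \<Longrightarrow> (u, v) \<in> parcs G"
  shows "rainbow_colorable G 1"
proof -
  have "rainbow_connected G (\<lambda>_. 1)"
    unfolding rainbow_connected_iff_joined
    using assms rainbow_joined_refl rainbow_joined_arc by metis
  then show ?thesis
    unfolding rainbow_colorable_def edge_coloring_def by force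
qed

section \<open>Layered graphs\<close>

lemma two_le_cardE:
  assumes "2 \<le> card S"
  obtains a b where "a \<in> S" "b \<in> S" "a \<noteq> b"
proof -
  obtain U where "U \<subseteq> S" "card U = 2"
    using obtain_subset_with_card_n[OF assms] by blast
  with that show thesis
    by (auto simp: card_2_iff)
qed

definition five_layering :: "'a pair_pre_digraph \<Rightarrow> ('a \<Rightarrow> nat) \<Rightarrow> bool" where
  "five_layering G l \<longleftrightarrow> {0, 1, 3, 4} \<subseteq> l ` pverts G \<and> l ` pverts G \<subseteq> {..4} \<and>
    (\<forall>u \<in> pverts G. \<forall>v \<in> pverts G. l u + 2 \<le> l v \<longrightarrow> (u, v) \<in> parcs G)"

definition layer_color :: "nat set \<Rightarrow> nat" where
  "layer_color S =
    (if S = {0, 3} \<or> S = {2, 4} then 2 else if S = {0, 4} then 3 else if S = {1, 4} then 4 else 1)"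

lemma rainbow_layer_walkE:
  assumes "i \<le> j" "j \<le> 4"
  obtains inner where "distinct inner" "set inner \<subseteq> {0, 1, 3, 4} - {i, j}"
    "\<forall>(a, b) \<in> set (vwalk_arcs (i # inner @ [j])). a + 2 \<le> b \<or> b + 2 \<le> a"
    "rainbow layer_color (vwalk_arcs (i # inner @ [j]))"
proof -
  define inner :: "nat list" where "inner =
    (if i + 2 \<le> j then []
     else if i = j then [[3, 1, 4], [3, 0, 4], [0, 4], [0, 4, 1], [0, 3, 1]] ! i
     else [[3], [4], [0], [0]] ! i)"
  have "i \<in> {0, 1, 2, 3, 4}" "j \<in> {0, 1, 2, 3, 4}"
    using assms by auto
  then have "distinct inner \<and> set inner \<subseteq> {0, 1, 3, 4} - {i, j} \<and>
    (\<forall>(a, b) \<in> set (vwalk_arcs (i # inner @ [j])). a + 2 \<le> b \<or> b + 2 \<le> a) \<and>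
    rainbow layer_color (vwalk_arcs (i # inner @ [j]))"
    using assms(1)
    by (elim insertE emptyE)
      (simp_all add: inner_def rainbow_def uedge_def layer_color_def doubleton_eq_iff)
  with that show thesis
    by blast
qed

lemma rainbow_vwalk_arcs_map:
  "rainbow c (vwalk_arcs (map l vs)) \<longleftrightarrow> rainbow (\<lambda>e. c (l ` e)) (vwalk_arcs vs)"
  by (simp add: rainbow_def vwalk_arcs_map uedge_def comp_def)

context pair_bidirected_digraph
begin

lemma five_layering_far_arc:
  assumes "five_layering G l" "u \<in> pverts G" "v \<in> pverts G" "l u + 2 \<le> l v \<or> l v + 2 \<le> l u"
  shows "(u, v) \<in> parcs G"
  using assms arcs_symmetric unfolding five_layering_def by blast

lemma five_layering_rainbow_joined_vpath:
  assumes l: "five_layering G l" and vs: "set vs \<subseteq> pverts G" "vs \<noteq> []" "distinct vs"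
    and far: "\<forall>(i, j) \<in> set (vwalk_arcs (map l vs)). i + 2 \<le> j \<or> j + 2 \<le> i"
    and rainbow: "rainbow c (vwalk_arcs (map l vs))"
  shows "rainbow_joined G (\<lambda>e. c (l ` e)) (hd vs) (last vs)"
proof (rule rainbow_joined_vpath)
  have "(a, b) \<in> parcs G" if "(a, b) \<in> set (vwalk_arcs vs)" for a b
  proof (rule five_layering_far_arc[OF l])
    show "a \<in> pverts G" "b \<in> pverts G"
      using that vs(1) by (auto elim: in_set_vwalk_arcsE)
    show "l a + 2 \<le> l b \<or> l b + 2 \<le> l a"
      using that far by (auto simp: vwalk_arcs_map)
  qed
  then show "vpath vs (with_proj G)"
    using vs by (auto simp: vpath_def vwalk_def)
  show "rainbow (\<lambda>e. c (l ` e)) (vwalk_arcs vs)"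
    using rainbow by (simp add: rainbow_vwalk_arcs_map)
qed

lemma five_layering_rainbow_joined:
  assumes l: "five_layering G l" and u: "u \<in> pverts G" and v: "v \<in> pverts G"
    and "u \<noteq> v" "l u \<le> l v"
  shows "rainbow_joined G (\<lambda>e. layer_color (l ` e)) u v"
proof -
  have "l v \<le> 4"
    using l v by (auto simp: five_layering_def)
  with \<open>l u \<le> l v\<close> obtain inner
    where inner: "distinct inner" "set inner \<subseteq> {0, 1, 3, 4} - {l u, l v}"
      and far: "\<forall>(i, j) \<in> set (vwalk_arcs (l u # inner @ [l v])). i + 2 \<le> j \<or> j + 2 \<le> i"
      and rainbow: "rainbow layer_color (vwalk_arcs (l u # inner @ [l v]))"
    by (rule rainbow_layer_walkE)
  define rep where "rep = inv_into (pverts G) l"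
  define vs where "vs = u # map rep inner @ [v]"
  have "{0, 1, 3, 4} \<subseteq> l ` pverts G"
    using l by (simp only: five_layering_def)
  with inner(2) have inhabited: "set inner \<subseteq> l ` pverts G"
    by (meson Diff_subset subset_trans)
  have rep: "l (rep i) = i" "rep i \<in> pverts G" if "i \<in> set inner" for i
    using subsetD[OF inhabited that] by (simp_all add: rep_def f_inv_into_f inv_into_into)
  have layers: "map l vs = l u # inner @ [l v]"
    using rep by (simp add: vs_def map_idI)
  have "distinct (map rep inner)"
    using inner(1) inhabited by (simp add: rep_def distinct_map inj_on_inv_into)
  moreover have "u \<notin> rep ` set inner" "v \<notin> rep ` set inner"
    using rep(1) inner(2) by auto
  ultimately have "distinct vs"
    using \<open>u \<noteq> v\<close> by (simp add: vs_def)
  moreover have "set vs \<subseteq> pverts G" "vs \<noteq> []"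
    using u v rep(2) by (auto simp: vs_def)
  ultimately have "rainbow_joined G (\<lambda>e. layer_color (l ` e)) (hd vs) (last vs)"
    by (intro five_layering_rainbow_joined_vpath[OF l] far[folded layers] rainbow[folded layers])
  then show ?thesis
    by (simp add: vs_def)
qed

lemma five_layering_imp_rainbow_colorable:
  assumes "five_layering G l"
  shows "rainbow_colorable G 4"
proof -
  let ?c = "\<lambda>e. layer_color (l ` e)"
  have "rainbow_joined G ?c u v" if "u \<in> pverts G" "v \<in> pverts G" for u v
    using five_layering_rainbow_joined[OF assms] that rainbow_joined_refl rainbow_joined_sym
    by (metis nat_le_linear)
  then have "rainbow_connected G ?c"
    by (simp add: rainbow_connected_iff_joined)
  moreover have "edge_coloring G 4 ?c"
    by (auto simp: edge_coloring_def layer_color_def)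
  ultimately show ?thesis
    unfolding rainbow_colorable_def by blast
qed

lemma five_layering_join:
  assumes "S \<union> T = pverts G" "S \<times> T \<subseteq> parcs G" "2 \<le> card S" "2 \<le> card T"
  shows "\<exists>l. five_layering G l"
proof -
  obtain a a' where S: "a \<in> S" "a' \<in> S" "a \<noteq> a'"
    using two_le_cardE[OF assms(3)] .
  obtain b b' where T: "b \<in> T" "b' \<in> T" "b \<noteq> b'"
    using two_le_cardE[OF assms(4)] .
  have "b \<notin> S" "b' \<notin> S"
    using assms(2) T no_loops' by auto
  define l :: "'a \<Rightarrow> nat" where
    "l v = (if v = a then 0 else if v \<in> S then 1 else if v = b then 3 else 4)" for v
  have "{0, 1, 3, 4} = l ` {a, a', b, b'}"
    using S T \<open>b \<notin> S\<close> \<open>b' \<notin> S\<close> by (auto simp: l_def)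
  also have "\<dots> \<subseteq> l ` pverts G"
    using S T assms(1) by (intro image_mono) auto
  finally have "{0, 1, 3, 4} \<subseteq> l ` pverts G" .
  moreover have "(u, v) \<in> parcs G" if "u \<in> pverts G" "v \<in> pverts G" "l u + 2 \<le> l v" for u v
    using that assms(1,2) S(1) by (auto simp: l_def split: if_splits)
  moreover have "l ` pverts G \<subseteq> {..4}"
    by (simp add: image_subset_iff l_def)
  ultimately have "five_layering G l"
    unfolding five_layering_def by (intro conjI ballI impI)
  then show ?thesis
    by blast
qed

end

section \<open>Distances\<close>

context wf_digraph
begin

definition hop_dist :: "'a \<Rightarrow> 'a \<Rightarrow> nat" where
  "hop_dist u v = (LEAST n. \<exists>p. awalk u p v \<and> length p = n)"

lemma hop_dist_le: "awalk u p v \<Longrightarrow> hop_dist u v \<le> length p"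
  unfolding hop_dist_def by (rule Least_le) blast

lemma hop_dist_attained:
  assumes "u \<rightarrow>\<^sup>* v"
  obtains p where "awalk u p v" "length p = hop_dist u v"
proof -
  have "\<exists>n p. awalk u p v \<and> length p = n"
    using assms by (simp add: reachable_awalk)
  then have "\<exists>p. awalk u p v \<and> length p = hop_dist u v"
    unfolding hop_dist_def by (rule LeastI_ex)
  with that show thesis by blast
qed

lemma hop_dist_self: "u \<in> verts G \<Longrightarrow> hop_dist u u = 0"
  using hop_dist_le[of u "[]" u] by (simp add: awalk_Nil_iff)

lemma hop_dist_ge_2:
  assumes "u \<rightarrow>\<^sup>* v" "u \<noteq> v" "\<not> u \<rightarrow> v"
  shows "2 \<le> hop_dist u v"
proof -
  obtain p where p: "awalk u p v" "length p = hop_dist u v"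
    using hop_dist_attained[OF assms(1)] .
  then show ?thesis
    using assms(2,3)
    by (cases p rule: list_exhaust_NSC) (auto simp: awalk_simps dest: in_arcs_imp_in_arcs_ends)
qed

lemma hop_dist_head_le:
  assumes "x \<rightarrow>\<^sup>* tail G e" "e \<in> arcs G"
  shows "hop_dist x (head G e) \<le> hop_dist x (tail G e) + 1"
proof -
  obtain p where p: "awalk x p (tail G e)" "length p = hop_dist x (tail G e)"
    using hop_dist_attained[OF assms(1)] .
  then have "awalk x (p @ [e]) (head G e)"
    using assms(2) by (simp add: awalk_simps)
  from hop_dist_le[OF this] p(2) show ?thesis
    by simp
qed

lemma awalk_cost_unit: "awalk_cost (\<lambda>_. 1) p = length p"
  by (induction p) auto

lemma mu_unit_eq_hop_dist:
  assumes "u \<rightarrow>\<^sup>* v"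
  shows "\<mu> (\<lambda>_. 1) u v = hop_dist u v"
proof -
  obtain p where p: "awalk u p v" "length p = hop_dist u v"
    using hop_dist_attained[OF assms] .
  show ?thesis
    unfolding \<mu>_def awalk_cost_unit
  proof (rule antisym)
    show "(INF p \<in> {p. awalk u p v}. ereal (length p)) \<le> hop_dist u v"
      using p by (auto intro!: INF_lower2[of p])
    show "hop_dist u v \<le> (INF p \<in> {p. awalk u p v}. ereal (length p))"
      by (auto intro!: INF_greatest hop_dist_le)
  qed
qed

lemma awalk_intermediate_value:
  fixes f :: "'a \<Rightarrow> nat"
  assumes "awalk u p v" and "\<And>e. e \<in> set p \<Longrightarrow> f (head G e) \<le> f (tail G e) + 1"
    and "f u \<le> i" "i \<le> f v"
  shows "\<exists>w \<in> set (awalk_verts u p). f w = i"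
  using assms
proof (induction p arbitrary: u)
  case Nil
  then show ?case by (simp add: awalk_Nil_iff)
next
  case (Cons e p)
  then have e: "u = tail G e" "awalk (head G e) p v"
    by (simp_all add: awalk_Cons_iff)
  show ?case
  proof (cases "f u = i")
    case True
    then show ?thesis using e by simp
  next
    case False
    then have "f (head G e) \<le> i"
      using Cons.prems(2)[of e] Cons.prems(3) e(1) by simp
    then show ?thesis
      using Cons.IH[OF e(2)] Cons.prems(2,4) by auto
  qed
qed

end

lemma (in pair_fin_digraph) diam_attained:
  assumes "strongly_connected (with_proj G)"
  obtains x y where "x \<in> pverts G" "y \<in> pverts G" "diam G = hop_dist x y"
    "\<And>u v. u \<in> pverts G \<Longrightarrow> v \<in> pverts G \<Longrightarrow> hop_dist u v \<le> hop_dist x y"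
proof -
  let ?D = "case_prod hop_dist ` (pverts G \<times> pverts G)"
  have "finite ?D" "?D \<noteq> {}"
    using pair_finite_verts assms by (auto simp: strongly_connected_def)
  then have "Max ?D \<in> ?D" and max: "\<And>d. d \<in> ?D \<Longrightarrow> d \<le> Max ?D"
    by (auto intro: Max_in Max_ge)
  then obtain x y where xy: "x \<in> pverts G" "y \<in> pverts G" and "Max ?D = hop_dist x y"
    by auto
  with max have le: "hop_dist u v \<le> hop_dist x y" if "u \<in> pverts G" "v \<in> pverts G" for u v
    using that by (metis SigmaI image_eqI old.prod.case)
  have "diam G = (SUP (u, v) \<in> pverts G \<times> pverts G. ereal (hop_dist u v))"
    unfolding diam_def using assms
    by (intro SUP_cong) (auto simp: mu_unit_eq_hop_dist strongly_connected_def)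
  also have "\<dots> = hop_dist x y"
    using xy le by (intro antisym SUP_least SUP_upper2[of "(x, y)"]) auto
  finally show thesis
    using that xy le by blast
qed

section \<open>Components\<close>

lemma (in sym_digraph) connected_iff_strongly_connected: "connected G \<longleftrightarrow> strongly_connected G"
proof
  show "strongly_connected G" if "connected G"
    using sym_arcs that by (rule symmetric_connected_imp_strongly_connected)
  show "connected G" if "strongly_connected G"
    using that by (intro connectedI) (auto simp: strongly_connected_def intro: reachable_mk_symmetricI)
qed

lemma (in wf_digraph) strongly_connected_imp_arcs_nonempty:
  assumes "strongly_connected G" "u \<in> verts G" "v \<in> verts G" "u \<noteq> v"
  shows "arcs G \<noteq> {}"
proof -
  have "u \<rightarrow>\<^sup>+ v"
    using assms by (auto simp: strongly_connected_def)
  then show ?thesis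
    by (auto simp: arcs_ends_conv)
qed

lemma (in wf_digraph) scc_of_subset_verts: "scc_of u \<subseteq> verts G"
  unfolding scc_of_def using reachable_in_verts(2) by blast

lemma (in wf_digraph) strongly_connectedI_scc_of:
  assumes "u \<in> verts G" "verts G \<subseteq> scc_of u"
  shows "strongly_connected G"
  using assms by (intro strongly_connectedI) (auto simp: scc_of_def intro: reachable_trans)

lemma (in wf_digraph) sccs_verts_eq_doubleton:
  assumes "a \<in> verts G" "verts G - scc_of a = {b}"
  shows "sccs_verts = {scc_of a, {b}}"
proof -
  have b: "b \<in> verts G" "b \<notin> scc_of a"
    using assms(2) by auto
  have "scc_of b = {b}"
  proof -
    have "v = b" if "v \<in> scc_of b" for v
    proof -
      have "v \<in> verts G"
        using that scc_of_subset_verts by blast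
      moreover have "v \<notin> scc_of a"
        using scc_of_eq[of v a] scc_of_eq[OF that] in_scc_of_self[OF b(1)] b(2) by auto
      ultimately show ?thesis
        using assms(2) by blast
    qed
    then show ?thesis
      using in_scc_of_self[OF b(1)] by blast
  qed
  moreover have "scc_of ` scc_of a = {scc_of a}"
    using scc_of_eq in_scc_of_self[OF assms(1)] by blast
  moreover have "verts G = insert b (scc_of a)"
    using assms(2) b(1) scc_of_subset_verts[of a] by blast
  ultimately show ?thesis
    by (simp add: sccs_verts_conv_scc_of insert_commute)
qed

lemma (in fin_digraph) two_le_card_verts_diff_scc_of:
  assumes "\<not> strongly_connected G" "u \<in> verts G"
    and "\<not> (card sccs = 2 \<and> (\<exists>C \<in> sccs. card (verts C) = 1))"
  shows "2 \<le> card (verts G - scc_of u)"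
proof (rule ccontr)
  assume "\<not> 2 \<le> card (verts G - scc_of u)"
  then have "card (verts G - scc_of u) = 0 \<or> card (verts G - scc_of u) = 1"
    by linarith
  then consider (empty) "verts G \<subseteq> scc_of u" | (singleton) b where "verts G - scc_of u = {b}"
    using finite_verts by (auto simp: card_1_singleton_iff)
  then show False
  proof cases
    case empty
    then show False
      using assms(1,2) strongly_connectedI_scc_of by blast
  next
    case singleton
    then have sccs_verts: "sccs_verts = {scc_of u, {b}}"
      using assms(2) by (intro sccs_verts_eq_doubleton)
    have "scc_of u \<noteq> {b}"
      using singleton by blast
    then have "card sccs = 2"
      using card_sccs_verts sccs_verts by simp
    moreover have "{b} \<in> verts ` sccs"
      by (simp add: sccs_verts flip: sccs_verts_conv)
    then have "\<exists>C \<in> sccs. card (verts C) = 1"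
      by (metis imageE is_singletonI is_singleton_altdef)
    ultimately show False
      using assms(3) by blast
  qed
qed

lemma (in wf_digraph) ex_trivial_scc_iff:
  "(\<exists>C \<in> sccs. card (verts C) = 1) \<longleftrightarrow> (\<exists>v \<in> verts G. card (scc_of v) = 1)"
proof -
  have "(\<exists>C \<in> sccs. card (verts C) = 1) \<longleftrightarrow> (\<exists>S \<in> sccs_verts. card S = 1)"
    by (simp add: sccs_verts_conv)
  also have "\<dots> \<longleftrightarrow> (\<exists>v \<in> verts G. card (scc_of v) = 1)"
    by (simp add: sccs_verts_conv_scc_of)
  finally show ?thesis .
qed

section \<open>The complement\<close>

lemma pair_graphI:
  assumes "finite (pverts G)" "parcs G \<subseteq> pverts G \<times> pverts G" "sym (parcs G)" "irrefl (parcs G)"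
  shows "pair_graph G"
proof -
  have "finite (parcs G)"
    using assms(1,2) by (metis finite_SigmaI finite_subset)
  then show ?thesis
    using assms by unfold_locales (auto simp: symmetric_def irrefl_def)
qed

lemma pverts_complement [simp]: "pverts (complement G) = pverts G"
  by (simp add: complement_def)

lemma parcs_complement:
  "(u, v) \<in> parcs (complement G) \<longleftrightarrow>
    u \<in> pverts G \<and> v \<in> pverts G \<and> u \<noteq> v \<and> (u, v) \<notin> parcs G"
  by (simp add: complement_def)

context pair_graph
begin

lemma pair_graph_complement: "pair_graph (complement G)"
  using pair_finite_verts arcs_symmetric
  by (intro pair_graphI) (auto simp: parcs_complement irrefl_def intro!: symI)

interpretation complement: pair_graph "complement G"
  by (rule pair_graph_complement)

lemma five_layering_complement_distance:
  assumes sc: "strongly_connected (with_proj (complement G))"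
    and x: "x \<in> pverts G" and y: "y \<in> pverts G" and far: "4 \<le> complement.hop_dist x y"
  shows "five_layering G (\<lambda>v. min 4 (complement.hop_dist x v))"
proof -
  let ?l = "\<lambda>v. min 4 (complement.hop_dist x v)"
  have reach: "u \<rightarrow>\<^sup>*\<^bsub>with_proj (complement G)\<^esub> v" if "u \<in> pverts G" "v \<in> pverts G" for u v
    using sc that by (simp add: strongly_connected_def)
  have step: "?l (snd e) \<le> ?l (fst e) + 1" if "e \<in> parcs (complement G)" for e
    using complement.hop_dist_head_le[of x e] reach[OF x] complement.arc_fst_in_verts[OF that] that
    by auto
  obtain p where p: "complement.awalk x p y"
    using complement.hop_dist_attained[OF reach[OF x y]] by blast
  then have arcs: "set p \<subseteq> parcs (complement G)" and verts: "set (pawalk_verts x p) \<subseteq> pverts G"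
    by (metis complement.awalkE pverts_complement)+
  have "{..4} \<subseteq> ?l ` pverts G"
  proof
    fix i :: nat assume "i \<in> {..4}"
    then have "?l x \<le> i" "i \<le> ?l y"
      using complement.hop_dist_self x far by auto
    then have "\<exists>w \<in> set (pawalk_verts x p). ?l w = i"
      using arcs step by (intro complement.awalk_intermediate_value[OF p]) auto
    then show "i \<in> ?l ` pverts G"
      using verts by blast
  qed
  moreover have "(u, v) \<in> parcs G" if "u \<in> pverts G" "v \<in> pverts G" "?l u + 2 \<le> ?l v" for u v
    using that step[of "(u, v)"] by (force simp: parcs_complement)
  ultimately show ?thesis
    unfolding five_layering_def by auto
qed

lemma five_layering_connected_complement:
  assumes "connected (with_proj (complement G))" "diam (complement G) \<notin> {2, 3}" "parcs G \<noteq> {}"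
  shows "\<exists>l. five_layering G l"
proof -
  have sc: "strongly_connected (with_proj (complement G))"
    using assms(1) by (simp add: complement.connected_iff_strongly_connected)
  then obtain x y where xy: "x \<in> pverts G" "y \<in> pverts G"
    and diam: "diam (complement G) = complement.hop_dist x y"
    and max: "\<And>u v. u \<in> pverts G \<Longrightarrow> v \<in> pverts G \<Longrightarrow>
      complement.hop_dist u v \<le> complement.hop_dist x y"
    using complement.diam_attained by auto
  obtain u v where uv: "(u, v) \<in> parcs G"
    using assms(3) by auto
  then have "u \<in> pverts G" "v \<in> pverts G" "u \<noteq> v"
    by (auto dest: in_arcsD1 in_arcsD2 no_loops')
  then have "2 \<le> complement.hop_dist u v"
    using sc uv
    by (intro complement.hop_dist_ge_2) (auto simp: strongly_connected_def parcs_complement)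
  also have "\<dots> \<le> complement.hop_dist x y"
    using max \<open>u \<in> pverts G\<close> \<open>v \<in> pverts G\<close> .
  finally have "2 \<le> complement.hop_dist x y" .
  moreover have "complement.hop_dist x y \<noteq> 2" "complement.hop_dist x y \<noteq> 3"
    using assms(2) diam by auto
  ultimately have "4 \<le> complement.hop_dist x y"
    by linarith
  then show ?thesis
    using five_layering_complement_distance[OF sc xy] by blast
qed

lemma scc_of_complement_joined:
  "complement.scc_of a \<times> (pverts G - complement.scc_of a) \<subseteq> parcs G"
proof clarify
  fix u v assume u: "u \<in> complement.scc_of a" and v: "v \<in> pverts G" "v \<notin> complement.scc_of a"
  then have "(u, v) \<notin> parcs (complement G)"
    using complement.scc_ofI_reachable'[of u v] complement.scc_of_eq[OF u] by auto
  moreover have "u \<in> pverts G"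
    using u complement.scc_of_subset_verts[of a] by auto
  ultimately show "(u, v) \<in> parcs G"
    using u v by (auto simp: parcs_complement)
qed

lemma five_layering_disconnected_complement:
  assumes "\<not> connected (with_proj (complement G))" "parcs (complement G) \<noteq> {}"
    and "\<not> (card complement.sccs = 2 \<and> (\<exists>C \<in> complement.sccs. card (verts C) = 1))"
  shows "\<exists>l. five_layering G l"
proof -
  obtain a a' where "(a, a') \<in> parcs (complement G)"
    using assms(2) by auto
  then have a: "a \<in> pverts G" "a \<noteq> a'" and a': "a' \<in> complement.scc_of a"
    by (auto simp: parcs_complement intro: complement.scc_ofI_reachable')
  let ?S = "complement.scc_of a" and ?T = "pverts G - complement.scc_of a"
  have "?S \<subseteq> pverts G"
    using complement.scc_of_subset_verts[of a] by simp
  have "{a, a'} \<subseteq> ?S"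
    using a(1) a' complement.in_scc_of_self by simp
  then have "2 \<le> card ?S"
    using card_mono[of ?S "{a, a'}"] finite_subset[OF \<open>?S \<subseteq> pverts G\<close> pair_finite_verts] a(2)
    by simp
  moreover have "2 \<le> card ?T"
    using complement.two_le_card_verts_diff_scc_of[of a] assms(1,3) a(1)
    by (simp add: complement.connected_iff_strongly_connected)
  moreover have "?S \<union> ?T = pverts G"
    using \<open>?S \<subseteq> pverts G\<close> by blast
  ultimately show ?thesis
    using scc_of_complement_joined by (intro five_layering_join[of ?S ?T])
qed

lemma rainbow_colorable_four:
  assumes "nontrivial_graph G" "connected (with_proj G)"
    and "\<not> (connected (with_proj (complement G)) \<and> diam (complement G) \<in> {2, 3})"
    and "\<not> (card (components (complement G)) = 2 \<and>
           (\<exists>C \<in> components (complement G). card (verts C) = 1))"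
  shows "rainbow_colorable G 4"
proof (cases "parcs (complement G) = {}")
  case True
  then have "(u, v) \<in> parcs G" if "u \<in> pverts G" "v \<in> pverts G" "u \<noteq> v" for u v
    using that parcs_complement[of u v G] by simp
  then have "rainbow_colorable G 1"
    by (rule rainbow_colorable_complete)
  then show ?thesis
    by (rule rainbow_colorable_mono) simp
next
  case False
  obtain u v where "u \<in> pverts G" "v \<in> pverts G" "u \<noteq> v"
    using assms(1) two_le_cardE unfolding nontrivial_graph_def by blast
  then have "parcs G \<noteq> {}"
    using assms(2) strongly_connected_imp_arcs_nonempty
    by (simp add: connected_iff_strongly_connected)
  have "\<exists>l. five_layering G l"
  proof (cases "connected (with_proj (complement G))")
    case True
    with assms(3) \<open>parcs G \<noteq> {}\<close> show ?thesis
      by (intro five_layering_connected_complement) simp_all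
  next
    case disconnected: False
    show ?thesis
      using disconnected False assms(4) by (rule five_layering_disconnected_complement)
  qed
  then show ?thesis
    using five_layering_imp_rainbow_colorable by blast
qed

end

section \<open>Sharpness\<close>

definition complete_bipartite :: "nat \<Rightarrow> nat \<Rightarrow> nat pair_pre_digraph" where
  "complete_bipartite m n =
    \<lparr> pverts = {..<m + n},
      parcs = {(u, v). u < m + n \<and> v < m + n \<and> (u < m \<longleftrightarrow> \<not> v < m)} \<rparr>"

lemma pverts_complete_bipartite [simp]: "pverts (complete_bipartite m n) = {..<m + n}"
  by (simp add: complete_bipartite_def)

lemma parcs_complete_bipartite:
  "(u, v) \<in> parcs (complete_bipartite m n) \<longleftrightarrow> u < m + n \<and> v < m + n \<and> (u < m \<longleftrightarrow> \<not> v < m)"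
  by (simp add: complete_bipartite_def)

interpretation K: pair_graph "complete_bipartite m n" for m n
  by (rule pair_graphI) (auto simp: parcs_complete_bipartite irrefl_def intro!: symI)

interpretation K_compl: pair_graph "complement (complete_bipartite m n)" for m n
  by (rule K.pair_graph_complement)

lemma connected_complete_bipartite:
  assumes "0 < m" "0 < n"
  shows "connected (with_proj (complete_bipartite m n))"
  unfolding K.connected_iff_strongly_connected
proof (rule strongly_connectedI)
  show "verts (with_proj (complete_bipartite m n)) \<noteq> {}"
    using assms by auto
  fix u v assume "u \<in> verts (with_proj (complete_bipartite m n))"
    "v \<in> verts (with_proj (complete_bipartite m n))"
  then have uv: "u < m + n" "v < m + n"
    by auto
  show "u \<rightarrow>\<^sup>*\<^bsub>with_proj (complete_bipartite m n)\<^esub> v"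
  proof (cases "u < m \<longleftrightarrow> v < m")
    case True
    define w where "w = (if u < m then m else 0)"
    have "(u, w) \<in> parcs (complete_bipartite m n)" "(w, v) \<in> parcs (complete_bipartite m n)"
      using True uv assms by (auto simp: parcs_complete_bipartite w_def)
    then show ?thesis
      by (meson K.adj_reachable_trans K.reachable_adjI)
  next
    case False
    then show ?thesis
      using uv by (auto simp: parcs_complete_bipartite)
  qed
qed

lemma reachable_complement_complete_bipartite:
  "u \<rightarrow>\<^sup>*\<^bsub>with_proj (complement (complete_bipartite m n))\<^esub> v \<longleftrightarrow>
    u < m + n \<and> v < m + n \<and> (u < m \<longleftrightarrow> v < m)" (is "?reach \<longleftrightarrow> ?same_side")
proof
  show ?same_side if ?reach
    using that
    by (induction rule: K_compl.reachable_induct) (auto simp: parcs_complement parcs_complete_bipartite)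
  show ?reach if ?same_side
    using that
    by (cases "u = v") (auto simp: parcs_complement parcs_complete_bipartite)
qed

lemma not_connected_complement_complete_bipartite:
  assumes "0 < m" "0 < n"
  shows "\<not> connected (with_proj (complement (complete_bipartite m n)))"
proof -
  have "\<not> 0 \<rightarrow>\<^sup>*\<^bsub>with_proj (complement (complete_bipartite m n))\<^esub> m"
    using assms by (simp add: reachable_complement_complete_bipartite)
  moreover have "0 \<in> pverts (complete_bipartite m n)" "m \<in> pverts (complete_bipartite m n)"
    using assms by simp_all
  ultimately show ?thesis
    unfolding K_compl.connected_iff_strongly_connected strongly_connected_def
    by (metis with_proj_simps(1) pverts_complement)
qed

lemma components_complement_complete_bipartite_nontrivial:
  assumes "2 \<le> m" "2 \<le> n"
  shows "\<not> (\<exists>C \<in> components (complement (complete_bipartite m n)). card (verts C) = 1)"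
proof -
  have "card (K_compl.scc_of m n v) \<noteq> 1" if "v < m + n" for v
  proof -
    have "K_compl.scc_of m n v = (if v < m then {..<m} else {m..<m + n})"
      using that
      by (auto simp: K_compl.scc_of_def reachable_complement_complete_bipartite)
    then show ?thesis
      using assms by simp
  qed
  then show ?thesis
    unfolding K_compl.ex_trivial_scc_iff by simp
qed

lemma even_length_awalk_complete_bipartite:
  "K.awalk m n u p v \<Longrightarrow> even (length p) \<longleftrightarrow> (u < m \<longleftrightarrow> v < m)"
  by (induction p arbitrary: u) (auto simp: K.awalk_simps parcs_complete_bipartite)

lemma complete_bipartite_equally_colored_vertices:
  assumes "edge_coloring (complete_bipartite m n) k c" "k ^ m < n"
  obtains w w' where "w \<in> {m..<m + n}" "w' \<in> {m..<m + n}" "w \<noteq> w'"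
    "\<And>a. a < m \<Longrightarrow> c {a, w} = c {a, w'}"
proof -
  define colors where "colors w = restrict (\<lambda>a. c {a, w}) {..<m}" for w
  have "c {a, w} \<in> {1..k}" if "a < m" "w \<in> {m..<m + n}" for a w
  proof -
    have "uedge (a, w) \<in> uedges (complete_bipartite m n)"
      unfolding uedges_def using that by (intro imageI) (auto simp: parcs_complete_bipartite)
    then show ?thesis
      using assms(1) unfolding edge_coloring_def uedge_def by (metis Pi_mem fst_conv snd_conv)
  qed
  then have "colors ` {m..<m + n} \<subseteq> {..<m} \<rightarrow>\<^sub>E {1..k}"
    unfolding colors_def by (intro image_subsetI restrict_PiE_iff[THEN iffD2]) simp
  then have "card (colors ` {m..<m + n}) \<le> card ({..<m} \<rightarrow>\<^sub>E {1..k})"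
    by (intro card_mono finite_PiE) auto
  also have "\<dots> < card {m..<m + n}"
    using assms(2) by (simp add: card_funcsetE)
  finally obtain w w' where w: "w \<in> {m..<m + n}" "w' \<in> {m..<m + n}" "w \<noteq> w'"
    and same: "colors w = colors w'"
    using pigeonhole by (metis inj_onI)
  have "c {a, w} = c {a, w'}" if "a < m" for a
    using fun_cong[OF same, of a] that by (simp add: colors_def)
  with that w show thesis
    by blast
qed

lemma complete_bipartite_not_rainbow_colorable_3:
  assumes "3 ^ m < n"
  shows "\<not> rainbow_colorable (complete_bipartite m n) 3"
proof
  assume "rainbow_colorable (complete_bipartite m n) 3"
  then obtain c where col: "edge_coloring (complete_bipartite m n) 3 c"
    and conn: "rainbow_connected (complete_bipartite m n) c"
    by (auto simp: rainbow_colorable_def)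
  obtain w w' where w: "w \<in> {m..<m + n}" "w' \<in> {m..<m + n}" "w \<noteq> w'"
    and same: "\<And>a. a < m \<Longrightarrow> c {a, w} = c {a, w'}"
    by (rule complete_bipartite_equally_colored_vertices[OF col assms]) blast
  obtain p where path: "K.apath m n w p w'" and rainbow: "rainbow c p"
    using conn w by (auto simp: rainbow_connected_def)
  have walk: "K.awalk m n w p w'"
    using path by (rule K.awalkI_apath)
  have "length p \<le> 3"
    using rainbow_length_le[OF col _ rainbow] walk by blast
  moreover have "even (length p)" "length p \<noteq> 0"
    using even_length_awalk_complete_bipartite[OF walk] walk w by (auto simp: K.awalk_Nil_iff)
  ultimately have "length p = 2"
    by presburger
  then obtain a where "p = [(w, a), (a, w')]" "a < m"
    using walk w
    by (auto simp: length_Suc_conv numeral_2_eq_2 K.awalk_simps parcs_complete_bipartite)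
  then have "c {a, w} \<noteq> c {a, w'}"
    using rainbow by (simp add: rainbow_def uedge_def insert_commute)
  with same \<open>a < m\<close> show False
    by blast
qed

lemma rc_complete_bipartite_eq_4:
  assumes "2 \<le> m" "3 ^ m < n"
  shows "rc (complete_bipartite m n) = 4"
proof (rule rc_eqI)
  have "2 \<le> n"
    using assms(2) one_le_power[of "3::nat" m] by linarith
  then have "\<exists>l. five_layering (complete_bipartite m n) l"
    using assms(1)
    by (intro K.five_layering_join[of "{..<m}" "{m..<m + n}"]) (auto simp: parcs_complete_bipartite)
  then show "rainbow_colorable (complete_bipartite m n) 4"
    using K.five_layering_imp_rainbow_colorable by blast
  show "4 \<le> k" if "rainbow_colorable (complete_bipartite m n) k" for k
  proof (rule ccontr)
    assume "\<not> 4 \<le> k"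
    then have "rainbow_colorable (complete_bipartite m n) 3"
      by (intro rainbow_colorable_mono[OF that]) simp
    then show False
      using complete_bipartite_not_rainbow_colorable_3[OF assms(2)] by contradiction
  qed
qed

theorem theorem1p1:
  shows "(\<forall>G :: 'a pair_pre_digraph.
            pair_graph G \<longrightarrow> nontrivial_graph G \<longrightarrow> connected (with_proj G) \<longrightarrow>
            \<not> (connected (with_proj (complement G)) \<and> diam (complement G) \<in> {2, 3}) \<longrightarrow>
            \<not> (card (components (complement G)) = 2 \<and>
               (\<exists>C \<in> components (complement G). card (verts C) = 1)) \<longrightarrow>
            rc G \<le> 4)
       \<and> (\<exists>G :: nat pair_pre_digraph.
            pair_graph G \<and> nontrivial_graph G \<and> connected (with_proj G) \<and>
            \<not> (connected (with_proj (complement G)) \<and> diam (complement G) \<in> {2, 3}) \<and>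
            \<not> (card (components (complement G)) = 2 \<and>
               (\<exists>C \<in> components (complement G). card (verts C) = 1)) \<and>
            rc G = 4)"
proof -
  let "?upper_bound \<and> ?sharpness" = ?thesis
  let ?K = "complete_bipartite 2 10"
  have ?upper_bound
    by (intro allI impI rc_le pair_graph.rainbow_colorable_four)
  moreover have ?sharpness
  proof (intro exI[of _ ?K] conjI)
    show "pair_graph ?K"
      by (rule K.pair_graph)
    show "nontrivial_graph ?K"
      by (simp add: nontrivial_graph_def)
    show "connected (with_proj ?K)"
      by (rule connected_complete_bipartite) simp_all
    show "\<not> (connected (with_proj (complement ?K)) \<and> diam (complement ?K) \<in> {2, 3})"
      using not_connected_complement_complete_bipartite[of 2 10] by simp
    show "\<not> (card (components (complement ?K)) = 2 \<and>
      (\<exists>C \<in> components (complement ?K). card (verts C) = 1))"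
      using components_complement_complete_bipartite_nontrivial[of 2 10] by simp
    show "rc ?K = 4"
      by (rule rc_complete_bipartite_eq_4) simp_all
  qed
  ultimately show ?thesis ..
qed

end
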